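(* Let $D$ be a Prüfer domain and let $P\in\operatorname{Spec}(D)$. The following are equivalent: (i) $P\in\operatorname{Spec}^\ast(D)$, i.e. $PD^\ast\neq D^\ast$; (ii) for every closed cocompact set $X$ of $\operatorname{Spec}(D)$ containing $P$, the rim closure $\rho(X)$ is dense in $\operatorname{Spec}(D)$.
   Context: A Prüfer domain is an integral domain $D$ such that $D_P$ is a valuation domain for every $P\in\operatorname{Spec}(D)$. Let $K$ be the quotient field of $D$. An element $z\in K$ is almost integral over $D$ if there is a nonzero $c\in D$ such that $cz^n\in D$ for every positive integer $n$; the complete integral closure $D^\ast$ of $D$ is the ring of all elements of $K$ that are almost integral over $D$. $\operatorname{Spec}^\ast(D)$ denotes the set of all $P\in\operatorname{Spec}(D)$ such that $PD^\ast\neq D^\ast$. The spectrum $\operatorname{Spec}(D)$ (the set of prime ideals of $D$) carries the Zariski topology, whose closed sets are the sets $\mathcal{V}(I)=\{P\in\operatorname{Spec}(D)\mid I\subseteq P\}$ with $I$ an ideal of $D$. A set $X\subseteq\operatorname{Spec}(D)$ is cocompact if $\operatorname{Spec}(D)\setminus X$ is compact (every open cover has a finite subcover; no Hausdorff condition). For $X\subseteq\operatorname{Spec}(D)$, a prime $P\in\operatorname{Spec}(D)$ is a rim element for $X$ if $P\notin X$ and there is a $Q\in X$ such that $P\subseteq Q$ and there is no prime ideal $L$ with $P\subsetneq L\subsetneq Q$. The rim closure $\rho(X)$ is the union of $X$ and the set of rim elements for $X$. *)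

theory Defs
  imports
    "HOL-Analysis.Abstract_Topology"
    "HOL-Algebra.Algebraic_Closure_Type"
    "HOL-Computational_Algebra.Computational_Algebra"
begin

(* The integral domain D is a type 'a :: idom and its quotient field K is 'a fract.  Ring-theoretic
   notions are those of HOL-Algebra, applied to the ring structures carried by these types. *)

abbreviation dom_ring :: "'a::idom ring"
  where "dom_ring \<equiv> ring_of_type_algebra"

abbreviation quot_field :: "'a::idom fract ring"
  where "quot_field \<equiv> ring_of_type_algebra"

definition spec :: "'a::idom set set"
  where "spec = {P. primeideal P dom_ring}"

definition zariski_closed :: "'a::idom set \<Rightarrow> 'a set set"
  where "zariski_closed I = {P \<in> spec. I \<subseteq> P}"

definition zariski :: "'a::idom set topology"
  where "zariski = topology (\<lambda>U. \<exists>I. ideal I dom_ring \<and> U = spec - zariski_closed I)"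

definition localization :: "'a::idom set \<Rightarrow> 'a fract set"
  where "localization P = {Fraction_Field.Fract a s | a s. s \<notin> P}"

(* The second condition says that V is a valuation domain and that the ambient field is its
   quotient field. *)
definition valuation_subring :: "'k::field set \<Rightarrow> bool"
  where "valuation_subring V \<longleftrightarrow>
    subring V ring_of_type_algebra \<and> (\<forall>x. x \<noteq> 0 \<longrightarrow> x \<in> V \<or> inverse x \<in> V)"

definition prufer_domain :: "'a::idom itself \<Rightarrow> bool"
  where "prufer_domain _ \<longleftrightarrow> (\<forall>P \<in> (spec :: 'a set set). valuation_subring (localization P))"

definition almost_integral :: "'a::idom fract \<Rightarrow> bool"
  where "almost_integral z \<longleftrightarrow>
    (\<exists>c. c \<noteq> 0 \<and> (\<forall>n::nat. n > 0 \<longrightarrow> to_fract c * z ^ n \<in> range to_fract))"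

definition complete_integral_closure :: "'a::idom fract set"
  where "complete_integral_closure = {z. almost_integral z}"

abbreviation cic_ring :: "'a::idom fract ring"
  where "cic_ring \<equiv> quot_field\<lparr>carrier := complete_integral_closure\<rparr>"

(* The extension P D^* of P to the complete integral closure D^* of D. *)
definition cic_extension :: "'a::idom set \<Rightarrow> 'a fract set"
  where "cic_extension P = genideal cic_ring (to_fract ` P)"

definition spec_star :: "'a::idom set set"
  where "spec_star = {P \<in> spec. cic_extension P \<noteq> complete_integral_closure}"

definition cocompact :: "'a::idom set set \<Rightarrow> bool"
  where "cocompact C \<longleftrightarrow> compactin zariski (spec - C)"

definition rim_element :: "'a::idom set set \<Rightarrow> 'a set \<Rightarrow> bool"
  where "rim_element C P \<longleftrightarrow> P \<in> spec \<and> P \<notin> C \<and>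
    (\<exists>Q \<in> C. P \<subseteq> Q \<and> \<not> (\<exists>L \<in> spec. P \<subset> L \<and> L \<subset> Q))"

definition rim_closure :: "'a::idom set set \<Rightarrow> 'a set set"
  where "rim_closure C = C \<union> {P. rim_element C P}"


lemma ring_of_type_algebra_simps:
  "carrier (ring_of_type_algebra :: 'b::comm_ring_1 ring) = UNIV"
  "monoid.mult (ring_of_type_algebra :: 'b::comm_ring_1 ring) x y = x * y"
  "monoid.one (ring_of_type_algebra :: 'b::comm_ring_1 ring) = 1"
  "ring.zero (ring_of_type_algebra :: 'b::comm_ring_1 ring) = 0"
  "ring.add (ring_of_type_algebra :: 'b::comm_ring_1 ring) x y = x + y"
  by (simp_all add: ring_of_type_algebra_def)

declare ring_of_type_algebra_simps [simp]

lemma zariski_closed_Int: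
  fixes I J :: "'a::idom set"
  assumes "ideal I dom_ring" "ideal J dom_ring"
  shows "zariski_closed (I \<inter> J) = zariski_closed I \<union> zariski_closed J"
proof -
  have "I \<subseteq> P \<or> J \<subseteq> P" if P: "primeideal P dom_ring" and sub: "I \<inter> J \<subseteq> P" for P :: "'a set"
  proof (rule ccontr)
    assume "\<not> (I \<subseteq> P \<or> J \<subseteq> P)"
    then obtain a b where ab: "a \<in> I" "a \<notin> P" "b \<in> J" "b \<notin> P" by blast
    have "a * b \<in> I" "a * b \<in> J"
      using ideal.I_r_closed[OF assms(1), of a b] ideal.I_l_closed[OF assms(2), of b a] ab by auto
    then have "a * b \<in> P" using sub by blast
    then show False using primeideal.I_prime[OF P, of a b] ab by auto
  qed
  then show ?thesis by (auto simp: zariski_closed_def spec_def)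
qed

lemma istopology_zariski:
  "istopology (\<lambda>U. \<exists>I. ideal I (dom_ring :: 'a::idom ring) \<and> U = spec - zariski_closed I)"
  unfolding istopology_def
proof (intro conjI allI impI)
  fix S T :: "'a set set"
  assume "\<exists>I. ideal I dom_ring \<and> S = spec - zariski_closed I"
    and "\<exists>I. ideal I dom_ring \<and> T = spec - zariski_closed I"
  then obtain I J where IJ: "ideal I dom_ring" "S = spec - zariski_closed I"
      "ideal J dom_ring" "T = spec - zariski_closed J" by blast
  then have "S \<inter> T = spec - zariski_closed (I \<inter> J)"
    using zariski_closed_Int[of I J] by blast
  moreover have "ideal (I \<inter> J) dom_ring"
    using IJ ring.i_intersect[OF ring_from_type_algebra] by blast
  ultimately show "\<exists>I. ideal I dom_ring \<and> S \<inter> T = spec - zariski_closed I" by blast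
next
  fix \<K> :: "'a set set set"
  assume K: "\<forall>U\<in>\<K>. \<exists>I. ideal I dom_ring \<and> U = spec - zariski_closed I"
  define A where "A = \<Union>{I. ideal I (dom_ring :: 'a ring) \<and> spec - zariski_closed I \<in> \<K>}"
  define J where "J = genideal dom_ring A"
  have J: "ideal J dom_ring" unfolding J_def
    by (rule ring.genideal_ideal[OF ring_from_type_algebra]) simp
  have sub: "J \<subseteq> P \<longleftrightarrow> A \<subseteq> P" if "P \<in> spec" for P
  proof -
    have "ideal P dom_ring" using that by (simp add: spec_def primeideal.axioms)
    then show ?thesis unfolding J_def
      using ring.Idl_subset_ideal[OF ring_from_type_algebra, of P A] by simp
  qed
  have "\<Union>\<K> = spec - zariski_closed J"
  proof (rule subset_antisym; rule subsetI)
    fix P assume "P \<in> \<Union>\<K>"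
    then obtain U where U: "U \<in> \<K>" "P \<in> U" by blast
    with K obtain I where I: "ideal I dom_ring" "U = spec - zariski_closed I" by blast
    have "I \<subseteq> A" using I U(1) unfolding A_def by auto
    then show "P \<in> spec - zariski_closed J"
      using U(2) sub[of P] unfolding I(2) zariski_closed_def by auto
  next
    fix P assume "P \<in> spec - zariski_closed J"
    then have P: "P \<in> spec" "\<not> A \<subseteq> P" using sub[of P] unfolding zariski_closed_def by auto
    then obtain I where I: "spec - zariski_closed I \<in> \<K>" "\<not> I \<subseteq> P" unfolding A_def by auto
    then have "P \<in> spec - zariski_closed I" using P(1) by (simp add: zariski_closed_def)
    then show "P \<in> \<Union>\<K>" using I(1) by (rule UnionI[rotated])
  qed
  then show "\<exists>I. ideal I dom_ring \<and> \<Union>\<K> = spec - zariski_closed I" using J by blast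
qed

lemma openin_zariski:
  "openin zariski U \<longleftrightarrow> (\<exists>I. ideal I dom_ring \<and> U = spec - zariski_closed I)"
  unfolding zariski_def by (simp add: topology_inverse'[OF istopology_zariski])

lemma topspace_zariski: "topspace (zariski :: 'a::idom set topology) = spec"
proof -
  have "ideal (carrier dom_ring) (dom_ring :: 'a ring)"
    by (rule ring.oneideal[OF ring_from_type_algebra])
  then have "ideal UNIV (dom_ring :: 'a ring)" by simp
  moreover have "zariski_closed (UNIV :: 'a set) = {}"
  proof -
    have "\<not> primeideal (UNIV :: 'a set) dom_ring"
      using primeideal.I_notcarr[of "UNIV :: 'a set" dom_ring] by auto
    then show ?thesis by (auto simp: zariski_closed_def spec_def top.extremum_unique)
  qed
  ultimately have "\<exists>I. ideal I (dom_ring :: 'a ring) \<and> spec = spec - zariski_closed I" by auto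
  then have "openin zariski (spec :: 'a set set)" by (simp only: openin_zariski)
  then have "spec \<subseteq> topspace (zariski :: 'a set topology)" by (rule openin_subset)
  moreover have "topspace (zariski :: 'a set topology) \<subseteq> spec"
    using openin_topspace[of "zariski :: 'a set topology"] unfolding openin_zariski by auto
  ultimately show ?thesis by (rule subset_antisym[rotated])
qed

lemma closedin_zariski:
  "closedin zariski C \<longleftrightarrow> (\<exists>I. ideal I dom_ring \<and> C = zariski_closed I)"
proof -
  have sub: "zariski_closed I \<subseteq> spec" for I :: "'a set" by (auto simp: zariski_closed_def)
  have eq: "(C \<subseteq> spec \<and> spec - C = spec - zariski_closed I) = (C = zariski_closed I)" for I
    using sub[of I] by blast
  have "closedin zariski C \<longleftrightarrow>
      (\<exists>I. ideal I dom_ring \<and> C \<subseteq> spec \<and> spec - C = spec - zariski_closed I)"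
    unfolding closedin_def topspace_zariski openin_zariski by iprover
  then show ?thesis by (simp only: eq)
qed

lemma range_to_fract_closed:
  fixes x y :: "'a::idom fract"
  assumes "x \<in> range to_fract" "y \<in> range to_fract"
  shows "x + y \<in> range to_fract" "x * y \<in> range to_fract" "- x \<in> range to_fract"
proof -
  obtain a b where ab: "x = to_fract a" "y = to_fract b" using assms by auto
  have "x + y = to_fract (a + b)" "x * y = to_fract (a * b)" "- x = to_fract (- a)"
    by (simp_all add: ab)
  then show "x + y \<in> range to_fract" "x * y \<in> range to_fract" "- x \<in> range to_fract"
    by blast+
qed

lemma almost_integralE:
  assumes "almost_integral z"
  obtains c where "c \<noteq> 0" "\<And>n. to_fract c * z ^ n \<in> range to_fract"
proof -
  obtain c where c: "c \<noteq> 0" "\<And>n. n > 0 \<Longrightarrow> to_fract c * z ^ n \<in> range to_fract"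
    using assms unfolding almost_integral_def by blast
  then have "to_fract c * z ^ n \<in> range to_fract" for n
    using c(2)[of n] by (cases "n = 0") auto
  with c(1) show thesis using that by blast
qed

lemma subring_complete_integral_closure: "subring complete_integral_closure quot_field"
proof (rule ring.subringI[OF ring_from_type_algebra])
  let ?R = "range to_fract :: 'a fract set"
  have uminus: "almost_integral (- x)" if x: "almost_integral x" for x :: "'a fract"
  proof -
    obtain c where c: "c \<noteq> 0" "\<And>n. to_fract c * x ^ n \<in> ?R"
      using almost_integralE[OF x] by metis
    have "to_fract c * (- x) ^ n \<in> ?R" for n
      using c(2)[of n] range_to_fract_closed(3)[OF c(2)[of n]]
      by (cases "even n") auto
    with c(1) show ?thesis unfolding almost_integral_def by blast
  qed
  have both: "almost_integral (x * y) \<and> almost_integral (x + y)"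
    if x: "almost_integral x" and y: "almost_integral y" for x y :: "'a fract"
  proof -
    obtain c where c: "c \<noteq> 0" "\<And>n. to_fract c * x ^ n \<in> ?R"
      using almost_integralE[OF x] by metis
    obtain d where d: "d \<noteq> 0" "\<And>n. to_fract d * y ^ n \<in> ?R"
      using almost_integralE[OF y] by metis
    have cd: "c * d \<noteq> 0" using c d by simp
    have tm: "to_fract (c * d) * (x ^ k * y ^ m) \<in> ?R" for k m
    proof -
      have "to_fract (c * d) * (x ^ k * y ^ m) = (to_fract c * x ^ k) * (to_fract d * y ^ m)"
        by (simp add: algebra_simps)
      then show ?thesis using range_to_fract_closed(2)[OF c(2)[of k] d(2)[of m]] by (simp only:)
    qed
    have nat: "of_nat m \<in> ?R" for m
    proof (induction m)
      case 0 then show ?case by (simp add: range_eqI[of _ _ 0])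
    next
      case (Suc m)
      have "1 \<in> ?R" by (simp add: range_eqI[of _ _ 1])
      then show ?case using Suc range_to_fract_closed(1) by simp
    qed
    have sum_closed: "finite A \<Longrightarrow> (\<And>i. i \<in> A \<Longrightarrow> f i \<in> ?R) \<Longrightarrow> sum f A \<in> ?R"
      for f and A :: "nat set"
    proof (induction A rule: finite_induct)
      case empty then show ?case by (simp add: range_eqI[of _ _ 0])
    next
      case (insert i A)
      then have "f i \<in> ?R" "sum f A \<in> ?R" by blast+
      from range_to_fract_closed(1)[OF this] show ?case
        using insert.hyps by (simp only: sum.insert not_False_eq_True)
    qed
    have "to_fract (c * d) * (x * y) ^ n \<in> ?R" for n
      using tm[of n n] by (simp only: power_mult_distrib)
    moreover have "to_fract (c * d) * (x + y) ^ n \<in> ?R" for n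
    proof -
      have "to_fract (c * d) * (x + y) ^ n =
          (\<Sum>k\<le>n. of_nat (n choose k) * (to_fract (c * d) * (x ^ k * y ^ (n - k))))"
        by (simp only: binomial_ring sum_distrib_left) (simp add: algebra_simps)
      moreover have "\<dots> \<in> ?R"
        by (rule sum_closed[OF finite_atMost]) (rule range_to_fract_closed(2)[OF nat tm])
      ultimately show ?thesis by simp
    qed
    ultimately show ?thesis using cd unfolding almost_integral_def by blast
  qed
  have "to_fract 1 * 1 ^ n \<in> ?R" for n :: nat by (simp add: range_eqI[of _ _ 1])
  then have one: "almost_integral (1 :: 'a fract)"
    unfolding almost_integral_def by (metis zero_neq_one)
  have inv: "\<ominus>\<^bsub>quot_field\<^esub> x = - x" for x :: "'a fract"
    by (rule abelian_group.minus_equality[OF ring.is_abelian_group[OF ring_from_type_algebra]])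
      simp_all
  show "complete_integral_closure \<subseteq> carrier quot_field" by simp
  show "\<one>\<^bsub>quot_field\<^esub> \<in> (complete_integral_closure :: 'a fract set)"
    using one by (simp add: complete_integral_closure_def)
  fix x y :: "'a fract"
  assume x: "x \<in> complete_integral_closure"
  then show "\<ominus>\<^bsub>quot_field\<^esub> x \<in> complete_integral_closure"
    unfolding inv using uminus by (simp add: complete_integral_closure_def)
  assume y: "y \<in> complete_integral_closure"
  show "x \<otimes>\<^bsub>quot_field\<^esub> y \<in> complete_integral_closure"
    and "x \<oplus>\<^bsub>quot_field\<^esub> y \<in> complete_integral_closure"
    using both x y by (simp_all add: complete_integral_closure_def)
qed

end

theory Submission
  imports Defs
begin

text \<open>
  The closed cocompact sets are the sets \<open>V(I)\<close> with \<open>I\<close> finitely generated.  For \<open>Q \<in> V(I)\<close> with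
  \<open>I \<noteq> 0\<close>, the ideal \<open>I D\<^sub>Q\<close> is generated by a single \<open>f \<in> I\<close>, and \<open>\<Inter>\<^sub>n f\<^sup>n D\<^sub>Q\<close> contracts to the
  largest prime inside \<open>Q\<close> outside \<open>V(I)\<close>; the rim elements are exactly these contractions.  Thus the rim closure of \<open>V(I)\<close> has intersection
  \<open>\<Inter>\<^sub>n I\<^sup>n\<close>, and it is dense iff this is \<open>0\<close>.  If \<open>1 = \<Sum> p\<^sub>i z\<^sub>i\<close> with \<open>p\<^sub>i \<in> P\<close> and \<open>z\<^sub>i \<in> D\<^sup>*\<close>, then expanding
  the \<open>n\<close>-th power shows that a common denominator of all monomials in the \<open>z\<^sub>i\<close> lies in \<open>\<Inter>\<^sub>n I\<^sup>n\<close>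
  for \<open>I = (p\<^sub>i)\<close>.  Conversely, \<open>0 \<noteq> c \<in> \<Inter>\<^sub>n I\<^sup>n\<close> with \<open>I \<subseteq> P\<close> gives \<open>I\<inverse> \<subseteq> D\<^sup>*\<close>, and \<open>I\<close> is
  invertible, so \<open>1 \<in> I I\<inverse> \<subseteq> P D\<^sup>*\<close>.
\<close>

section \<open>Ideals and prime ideals in elementwise form\<close>

lemma ideal_dom_ring_iff:
  fixes I :: "'a::idom set"
  shows "ideal I dom_ring \<longleftrightarrow>
    0 \<in> I \<and> (\<forall>x\<in>I. \<forall>y\<in>I. x + y \<in> I) \<and> (\<forall>x\<in>I. \<forall>r. r * x \<in> I)"
proof
  assume I: "ideal I dom_ring"
  show "0 \<in> I \<and> (\<forall>x\<in>I. \<forall>y\<in>I. x + y \<in> I) \<and> (\<forall>x\<in>I. \<forall>r. r * x \<in> I)"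
    using additive_subgroup.zero_closed[OF ideal.axioms(1)[OF I]]
      additive_subgroup.a_closed[OF ideal.axioms(1)[OF I]] ideal.I_l_closed[OF I]
    by auto
next
  assume I: "0 \<in> I \<and> (\<forall>x\<in>I. \<forall>y\<in>I. x + y \<in> I) \<and> (\<forall>x\<in>I. \<forall>r. r * x \<in> I)"
  have inv: "\<ominus>\<^bsub>dom_ring\<^esub> x = - x" for x :: 'a
    by (rule abelian_group.minus_equality[OF ring.is_abelian_group[OF ring_from_type_algebra]])
      simp_all
  have neg: "- x \<in> I" if "x \<in> I" for x
    using I that by (metis mult_minus1)
  show "ideal I dom_ring"
  proof (rule idealI[OF ring_from_type_algebra])
    show "subgroup I (add_monoid dom_ring)"
    proof (rule group.subgroupI)
      show "group (add_monoid (dom_ring :: 'a ring))"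
        by (rule abelian_group.a_group[OF ring.is_abelian_group[OF ring_from_type_algebra]])
      show "inv\<^bsub>add_monoid dom_ring\<^esub> x \<in> I" if "x \<in> I" for x
        using neg[OF that] inv[of x] unfolding a_inv_def by simp
    qed (use I in auto)
  qed (use I in \<open>auto simp: mult.commute\<close>)
qed

lemma spec_iff:
  fixes P :: "'a::idom set"
  shows "P \<in> spec \<longleftrightarrow>
    ideal P dom_ring \<and> 1 \<notin> P \<and> (\<forall>x y. x * y \<in> P \<longrightarrow> x \<in> P \<or> y \<in> P)"
proof
  assume "P \<in> spec"
  then have P: "primeideal P dom_ring" by (simp add: spec_def)
  then have I: "ideal P dom_ring" by (rule primeideal.axioms)
  have "1 \<notin> P"
    using I primeideal.I_notcarr[OF P] unfolding ideal_dom_ring_iff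
    by simp (metis UNIV_eq_I mult.right_neutral)
  then show "ideal P dom_ring \<and> 1 \<notin> P \<and> (\<forall>x y. x * y \<in> P \<longrightarrow> x \<in> P \<or> y \<in> P)"
    using I primeideal.I_prime[OF P] by simp
next
  assume P: "ideal P dom_ring \<and> 1 \<notin> P \<and> (\<forall>x y. x * y \<in> P \<longrightarrow> x \<in> P \<or> y \<in> P)"
  have "cring (dom_ring :: 'a ring)"
    by (rule cring_from_type_algebra)
  then show "P \<in> spec" using P unfolding spec_def
    by (auto intro!: primeidealI) blast
qed

context
  fixes P :: "'a::idom set"
  assumes P: "P \<in> spec"
begin

lemma spec_0: "0 \<in> P" and spec_1: "1 \<notin> P"
  and spec_add: "x \<in> P \<Longrightarrow> y \<in> P \<Longrightarrow> x + y \<in> P"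
  and spec_mult: "x * y \<in> P \<longleftrightarrow> x \<in> P \<or> y \<in> P"
  using P unfolding spec_iff ideal_dom_ring_iff by (auto, metis mult.commute)

lemma spec_dvd: "x \<in> P \<Longrightarrow> x dvd y \<Longrightarrow> y \<in> P"
  using spec_mult by (auto elim: dvdE)

lemma spec_power: "x \<notin> P \<Longrightarrow> x ^ n \<notin> P"
  by (induction n) (auto simp: spec_1 spec_mult)

lemma spec_powerD: "x ^ n \<in> P \<Longrightarrow> x \<in> P"
  using spec_power by blast

lemma spec_nonzero: "x \<notin> P \<Longrightarrow> x \<noteq> 0"
  using spec_0 by auto

end

lemma zero_in_spec: "{0} \<in> (spec :: 'a::idom set set)"
  unfolding spec_iff ideal_dom_ring_iff by auto

section \<open>Primes above an ideal\<close>

text \<open>An ideal maximal among those that contain \<open>J\<close> and miss every power of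
  \<open>f\<close> is prime. As \<open>f ^ 0 = 1\<close> counts as a power, such ideals are proper,
  and \<open>f = 1\<close> yields a prime above any proper ideal.\<close>

lemma exists_prime_avoiding_powers:
  fixes J :: "'a::idom set"
  assumes J: "ideal J dom_ring" and f: "\<And>n. f ^ n \<notin> J"
  shows "\<exists>Q\<in>spec. J \<subseteq> Q \<and> f \<notin> Q"
proof -
  define S where "S = {I. ideal I dom_ring \<and> J \<subseteq> I \<and> (\<forall>n. f ^ n \<notin> I)}"
  have "S \<noteq> {}" using J f unfolding S_def by auto
  moreover have "\<Union>\<C> \<in> S" if ne: "\<C> \<noteq> {}" and chain: "subset.chain S \<C>" for \<C>
  proof -
    have sub: "\<C> \<subseteq> S" using chain by (simp add: subset.chain_def)
    have "x + y \<in> \<Union>\<C>" if xy: "x \<in> \<Union>\<C>" "y \<in> \<Union>\<C>" for x y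
    proof -
      obtain A B where AB: "A \<in> \<C>" "B \<in> \<C>" "x \<in> A" "y \<in> B" using xy by blast
      then have "A \<subseteq> B \<or> B \<subseteq> A" using chain by (auto simp: subset.chain_def)
      then obtain E where "E \<in> \<C>" "x \<in> E" "y \<in> E" using AB by blast
      then show ?thesis using sub unfolding S_def ideal_dom_ring_iff by blast
    qed
    moreover have "0 \<in> \<Union>\<C>"
      using ne sub unfolding S_def ideal_dom_ring_iff by auto
    moreover have "r * x \<in> \<Union>\<C>" if x: "x \<in> \<Union>\<C>" for x r
    proof -
      obtain A where A: "A \<in> \<C>" "x \<in> A" using x by blast
      then have "r * x \<in> A" using sub unfolding S_def ideal_dom_ring_iff by auto
      then show ?thesis using A by blast
    qed
    ultimately have "ideal (\<Union>\<C>) dom_ring"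
      unfolding ideal_dom_ring_iff by simp
    then show ?thesis using ne sub unfolding S_def by blast
  qed
  ultimately obtain M where M: "M \<in> S" "\<forall>N\<in>S. M \<subseteq> N \<longrightarrow> N = M"
    using subset_Zorn_nonempty[of S] by blast
  have Mid: "0 \<in> M" "\<And>x y. x \<in> M \<Longrightarrow> y \<in> M \<Longrightarrow> x + y \<in> M" "\<And>x r. x \<in> M \<Longrightarrow> r * x \<in> M"
    and fM: "\<And>n. f ^ n \<notin> M" and JM: "J \<subseteq> M"
    using M(1) unfolding S_def ideal_dom_ring_iff by auto
  \<comment> \<open>Maximality: for \<open>x\<close> outside \<open>M\<close>, the larger ideal
    \<open>M + (x)\<close> must meet the powers of \<open>f\<close>.\<close>
  have pow: "\<exists>n m r. m \<in> M \<and> f ^ n = m + r * x" if x: "x \<notin> M" for x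
  proof -
    define N where "N = {m + r * x | m r. m \<in> M}"
    have mem: "m + r * x \<in> N" if "m \<in> M" for m r using that N_def by blast
    have "ideal N dom_ring" unfolding ideal_dom_ring_iff
    proof (intro conjI ballI allI)
      show "0 \<in> N" using mem[of 0 0] Mid by simp
    next
      fix u v assume "u \<in> N" "v \<in> N"
      then obtain m r m' r' where "u = m + r * x" "v = m' + r' * x" "m \<in> M" "m' \<in> M"
        unfolding N_def by blast
      then show "u + v \<in> N" using mem[of "m + m'" "r + r'"] Mid by (simp add: algebra_simps)
    next
      fix u s assume "u \<in> N"
      then obtain m r where "u = m + r * x" "m \<in> M" unfolding N_def by blast
      then show "s * u \<in> N" using mem[of "s * m" "s * r"] Mid by (simp add: algebra_simps)
    qed
    moreover have MN: "M \<subseteq> N" using mem[of _ 0] by auto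
    moreover have "N \<noteq> M" using mem[of 0 1] Mid x by auto
    ultimately have "\<exists>n. f ^ n \<in> N" using M(2) JM unfolding S_def by blast
    then show ?thesis unfolding N_def by blast
  qed
  have "M \<in> spec" unfolding spec_iff
  proof (intro conjI allI impI)
    show "ideal M dom_ring" using M(1) by (simp add: S_def)
    show "1 \<notin> M" using fM[of 0] by simp
  next
    fix x y assume xy: "x * y \<in> M"
    show "x \<in> M \<or> y \<in> M"
    proof (rule ccontr)
      assume "\<not> (x \<in> M \<or> y \<in> M)"
      then obtain n m r n' m' r' where *: "m \<in> M" "f ^ n = m + r * x" "m' \<in> M" "f ^ n' = m' + r' * y"
        using pow by meson
      \<comment> \<open>Multiplying the two expressions leaves only terms in \<open>M\<close>, the
        last one because \<open>x * y\<close> lies there.\<close>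
      have "f ^ (n + n') = (m' + r' * y) * m + (r * x) * m' + (r * r') * (x * y)"
        unfolding power_add *(2,4) by (simp add: algebra_simps)
      also have "\<dots> \<in> M" by (intro Mid(2,3) *(1,3) xy)
      finally show False using fM by blast
    qed
  qed
  moreover have "f \<notin> M" using fM[of 1] by simp
  ultimately show ?thesis using JM by blast
qed

lemma exists_prime_above:
  fixes J :: "'a::idom set"
  assumes "ideal J dom_ring" and "1 \<notin> J"
  shows "\<exists>Q\<in>spec. J \<subseteq> Q"
  using exists_prime_avoiding_powers[of J 1] assms by auto

section \<open>The Zariski topology: compactness and density\<close>

lemma ideal_principal: "ideal {x. a dvd x} (dom_ring :: 'a::idom ring)"
  unfolding ideal_dom_ring_iff by auto

lemma zariski_closed_singleton: "zariski_closed {a} = zariski_closed {x. a dvd (x::'a::idom)}"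
  unfolding zariski_closed_def by (auto intro: spec_dvd)

lemma openin_zariski_basic: "openin zariski (spec - zariski_closed {a :: 'a::idom})"
  unfolding zariski_closed_singleton openin_zariski using ideal_principal by blast

lemma closedin_zariski_singleton: "closedin zariski (zariski_closed {a :: 'a::idom})"
  unfolding zariski_closed_singleton closedin_zariski using ideal_principal by blast

text \<open>The members of a cover are complements of sets V(I). That they cover the basic open set
  of \<open>f\<close> means that no prime contains all these I and misses \<open>f\<close>, so some
  power of \<open>f\<close> lies in their sum, hence in an ideal with finitely many generators. One
  member of the cover per generator suffices.\<close>

lemma compactin_zariski_basic: "compactin zariski (spec - zariski_closed {f :: 'a::idom})"
  unfolding compactin_def topspace_zariski
proof (intro conjI allI impI)
  fix \<U> :: "'a set set set"
  assume U: "Ball \<U> (openin zariski) \<and> spec - zariski_closed {f} \<subseteq> \<Union>\<U>"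
  define A where "A = (\<Union>U\<in>\<U>. \<Union>{I. ideal I dom_ring \<and> U = spec - zariski_closed I})"
  \<comment> \<open>\<open>J\<close> is the ideal generated by \<open>A\<close>; the finite subsets
    \<open>B\<close> keep track of the finitely many generators that an element uses.\<close>
  define J where "J = {x. \<exists>B. finite B \<and> B \<subseteq> A \<and> (\<forall>I. ideal I dom_ring \<longrightarrow> B \<subseteq> I \<longrightarrow> x \<in> I)}"
  have AJ: "A \<subseteq> J"
  proof
    fix a assume "a \<in> A" then show "a \<in> J" unfolding J_def by (auto intro!: exI[of _ "{a}"])
  qed
  have "ideal J dom_ring" unfolding ideal_dom_ring_iff
  proof (intro conjI ballI allI)
    show "0 \<in> J" unfolding J_def by (auto intro!: exI[of _ "{}"] simp: ideal_dom_ring_iff)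
  next
    fix x y assume "x \<in> J" "y \<in> J"
    then obtain B B' where
      "finite B" "B \<subseteq> A" "\<forall>I. ideal I dom_ring \<longrightarrow> B \<subseteq> I \<longrightarrow> x \<in> I"
      "finite B'" "B' \<subseteq> A" "\<forall>I. ideal I dom_ring \<longrightarrow> B' \<subseteq> I \<longrightarrow> y \<in> I"
      unfolding J_def by blast
    then show "x + y \<in> J" unfolding J_def
      by (auto intro!: exI[of _ "B \<union> B'"] simp: ideal_dom_ring_iff)
  next
    fix x r assume "x \<in> J"
    then obtain B where "finite B" "B \<subseteq> A" "\<forall>I. ideal I dom_ring \<longrightarrow> B \<subseteq> I \<longrightarrow> x \<in> I"
      unfolding J_def by blast
    then show "r * x \<in> J" unfolding J_def
      by (auto intro!: exI[of _ B] simp: ideal_dom_ring_iff)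
  qed
  moreover have "\<not> (\<exists>Q\<in>spec. J \<subseteq> Q \<and> f \<notin> Q)"
  proof
    assume "\<exists>Q\<in>spec. J \<subseteq> Q \<and> f \<notin> Q"
    then obtain Q where Q: "Q \<in> spec" "A \<subseteq> Q" "f \<notin> Q" using AJ by blast
    then obtain V where V: "V \<in> \<U>" "Q \<in> V" using U unfolding zariski_closed_def by blast
    then obtain I where I: "ideal I dom_ring" "V = spec - zariski_closed I"
      using U unfolding openin_zariski by blast
    then have "I \<subseteq> Q" using V(1) Q(2) unfolding A_def by blast
    then show False using V(2) I(2) Q(1) by (simp add: zariski_closed_def)
  qed
  ultimately obtain n where "f ^ n \<in> J" using exists_prime_avoiding_powers by blast
  then obtain B where B: "finite B" "B \<subseteq> A" "\<forall>I. ideal I dom_ring \<longrightarrow> B \<subseteq> I \<longrightarrow> f ^ n \<in> I"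
    unfolding J_def by blast
  have "\<forall>b\<in>B. \<exists>V. V \<in> \<U> \<and> (\<exists>I. ideal I dom_ring \<and> V = spec - zariski_closed I \<and> b \<in> I)"
    using B(2) unfolding A_def by blast
  then obtain V where V: "\<And>b. b \<in> B \<Longrightarrow> V b \<in> \<U>"
    "\<And>b. b \<in> B \<Longrightarrow> \<exists>I. ideal I dom_ring \<and> V b = spec - zariski_closed I \<and> b \<in> I"
    by metis
  have "spec - zariski_closed {f} \<subseteq> \<Union>(V ` B)"
  proof
    fix Q assume "Q \<in> spec - zariski_closed {f}"
    then have Q: "Q \<in> spec" "f \<notin> Q" by (auto simp: zariski_closed_def)
    then have "\<not> B \<subseteq> Q" using B(3) spec_power[OF Q(1,2)] spec_iff by blast
    then obtain b where b: "b \<in> B" "b \<notin> Q" by blast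
    then have "Q \<in> V b" using V(2)[OF b(1)] Q(1) unfolding zariski_closed_def by blast
    then show "Q \<in> \<Union>(V ` B)" using b(1) by blast
  qed
  then show "\<exists>\<F>. finite \<F> \<and> \<F> \<subseteq> \<U> \<and> spec - zariski_closed {f} \<subseteq> \<Union>\<F>"
    using B(1) V(1) by (intro exI[of _ "V ` B"]) auto
qed auto

lemma spec_minus_zariski_closed:
  "spec - zariski_closed F = (\<Union>f\<in>F. spec - zariski_closed {f :: 'a::idom})"
  unfolding zariski_closed_def by auto

text \<open>The complement of V(F) is a finite union of basic open sets, each of them
  compact.\<close>

lemma closedin_cocompact_finite:
  fixes F :: "'a::idom set"
  assumes "finite F"
  shows "closedin zariski (zariski_closed F)" "cocompact (zariski_closed F)"
proof -
  have "openin zariski (spec - zariski_closed F)"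
    unfolding spec_minus_zariski_closed[of F] using openin_zariski_basic by blast
  then show "closedin zariski (zariski_closed F)"
    by (auto simp: closedin_def topspace_zariski zariski_closed_def)
  show "cocompact (zariski_closed F)"
    unfolding cocompact_def spec_minus_zariski_closed[of F]
    using assms compactin_zariski_basic by (intro compactin_Union) auto
qed

text \<open>If the set is V(I), its complement is covered by the basic open sets of the elements of
  I; a finite subcover names finitely many elements that already cut out V(I).\<close>

lemma closed_cocompact_finiteE:
  fixes C :: "'a::idom set set"
  assumes "closedin zariski C" "cocompact C"
  obtains F where "finite F" "C = zariski_closed F"
proof -
  obtain I where I: "C = zariski_closed I" using assms(1) closedin_zariski by blast
  have sub: "C \<subseteq> spec" unfolding I zariski_closed_def by blast
  let ?\<U> = "(\<lambda>f. spec - zariski_closed {f}) ` I"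
  have "Ball ?\<U> (openin zariski)" using openin_zariski_basic by blast
  moreover have "spec - C \<subseteq> \<Union>?\<U>" unfolding I using spec_minus_zariski_closed by blast
  ultimately obtain \<F> where \<F>: "finite \<F>" "\<F> \<subseteq> ?\<U>" "spec - C \<subseteq> \<Union>\<F>"
    using assms(2) unfolding cocompact_def compactin_def by meson
  then obtain F where F: "F \<subseteq> I" "finite F" "\<F> = (\<lambda>f. spec - zariski_closed {f}) ` F"
    using finite_subset_image by metis
  have "spec - C \<subseteq> spec - zariski_closed F"
    using \<F>(3) unfolding F(3) spec_minus_zariski_closed[of F] .
  moreover have "C \<subseteq> zariski_closed F" unfolding I using F(1) by (auto simp: zariski_closed_def)
  moreover have "zariski_closed F \<subseteq> spec" by (auto simp: zariski_closed_def)
  ultimately have "C = zariski_closed F" using sub by blast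
  with F(2) show thesis using that by blast
qed

lemma rim_closure_subset_spec: "C \<subseteq> spec \<Longrightarrow> rim_closure C \<subseteq> spec"
  unfolding rim_closure_def rim_element_def by blast

text \<open>A closed set V(J) contains \<open>S\<close> iff J lies in the intersection of
  \<open>S\<close>; if that is zero, V(J) is the whole spectrum. Conversely, each \<open>c\<close>
  in the intersection gives a closed set V(c) containing \<open>S\<close>, and density puts the zero
  prime into it.\<close>

lemma zariski_dense_iff:
  fixes S :: "'a::idom set set"
  assumes "S \<subseteq> spec"
  shows "zariski closure_of S = spec \<longleftrightarrow> \<Inter>S \<subseteq> {0}"
proof
  assume d: "zariski closure_of S = spec"
  show "\<Inter>S \<subseteq> {0}"
  proof
    fix c assume "c \<in> \<Inter>S"
    then have "S \<subseteq> zariski_closed {c}" using assms by (auto simp: zariski_closed_def)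
    then have "zariski closure_of S \<subseteq> zariski_closed {c}"
      using closedin_zariski_singleton by (rule closure_of_minimal)
    then show "c \<in> {0}" using d zero_in_spec by (auto simp: zariski_closed_def)
  qed
next
  assume d: "\<Inter>S \<subseteq> {0}"
  have "closedin zariski (zariski closure_of S)" by simp
  then obtain J where J: "zariski closure_of S = zariski_closed J"
    using closedin_zariski by blast
  moreover have "S \<subseteq> zariski closure_of S"
    by (rule closure_of_subset) (simp add: topspace_zariski assms)
  ultimately have "J \<subseteq> {0}" using d unfolding zariski_closed_def by blast
  then have "zariski_closed J = spec" using spec_0 unfolding zariski_closed_def by blast
  then show "zariski closure_of S = spec" using J by simp
qed

section \<open>Divisibility and primes in the localizations of a Pruefer domain\<close>

text \<open>Comparability of \<open>a\<close> and \<open>b\<close> in the valuation ring D_Q, with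
  denominators cleared: for nonzero \<open>b\<close>, the fraction a/b lies in D_Q iff
  \<open>b\<close> divides \<open>s * a\<close> for some \<open>s\<close> outside
  \<open>Q\<close>.\<close>

lemma prufer_compare:
  fixes Q :: "'a::idom set"
  assumes "prufer_domain TYPE('a)" and Q: "Q \<in> spec"
  shows "\<exists>s. s \<notin> Q \<and> (b dvd s * a \<or> a dvd s * b)"
proof (cases "a = 0 \<or> b = 0")
  case True
  then show ?thesis using spec_1[OF Q] by auto
next
  case False
  have *: "\<exists>s. s \<notin> Q \<and> v dvd s * u"
    if uv: "Fraction_Field.Fract u v \<in> localization Q" "v \<noteq> 0" for u v :: 'a
  proof -
    obtain c s where s: "s \<notin> Q" "Fraction_Field.Fract u v = Fraction_Field.Fract c s"
      using uv(1) unfolding localization_def by blast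
    then have "u * s = c * v" using uv(2) spec_nonzero[OF Q s(1)] by (simp add: eq_fract)
    then show ?thesis using s(1) by (metis dvd_triv_right mult.commute)
  qed
  have "valuation_subring (localization Q)" using assms unfolding prufer_domain_def by blast
  moreover have "Fraction_Field.Fract a b \<noteq> 0" using False by (simp add: Zero_fract_def eq_fract)
  ultimately have "Fraction_Field.Fract a b \<in> localization Q \<or>
      Fraction_Field.Fract b a \<in> localization Q"
    unfolding valuation_subring_def by (metis inverse_fract)
  then show ?thesis using *[of a b] *[of b a] False by blast
qed

text \<open>In the valuation ring D_Q one of finitely many elements divides all the others. The
  induction keeps the old generator or replaces it by the new element \<open>x\<close>, and
  multiplies the denominators.\<close>

lemma prufer_locally_principal:
  fixes Q :: "'a::idom set"
  assumes pr: "prufer_domain TYPE('a)" and Q: "Q \<in> spec"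
    and "finite F" "F \<noteq> {}"
  shows "\<exists>f\<in>F. \<exists>s. s \<notin> Q \<and> (\<forall>g\<in>F. f dvd s * g)"
  using assms(3,4)
proof (induction rule: finite_ne_induct)
  case (singleton x)
  then show ?case using spec_1[OF Q] by (auto intro!: exI[of _ 1])
next
  case (insert x F)
  then obtain f s where fs: "f \<in> F" "s \<notin> Q" "\<forall>g\<in>F. f dvd s * g" by blast
  obtain t where t: "t \<notin> Q" "f dvd t * x \<or> x dvd t * f"
    using prufer_compare[OF pr Q] by blast
  have st: "s * t \<notin> Q" using fs t spec_mult[OF Q] by blast
  from t(2) show ?case
  proof
    assume "f dvd t * x"
    then have "\<forall>g\<in>insert x F. f dvd (s * t) * g"
      using fs(3) by (auto simp: mult.assoc) (metis dvd_mult mult.left_commute)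
    then show ?thesis using fs(1) st by blast
  next
    assume x: "x dvd t * f"
    have "x dvd (s * t) * g" if "g \<in> F" for g
    proof -
      have "t * f dvd t * (s * g)" using fs(3) that by (auto intro: mult_dvd_mono)
      then show ?thesis using x by (metis dvd_trans mult.assoc mult.commute)
    qed
    then show ?thesis using st by (intro bexI[of _ x]) auto
  qed
qed

text \<open>The contractions to \<open>D\<close> of \<open>\<Inter>\<^sub>n p\<^sup>n D\<^sub>Q\<close> and of the radical of \<open>p D\<^sub>Q\<close>.  For \<open>0 \<noteq> p \<in> Q\<close> in
  a Pruefer domain they are the largest prime inside \<open>Q\<close> without \<open>p\<close> and the smallest one with \<open>p\<close>,
  hence adjacent.\<close>

definition loc_power_inter :: "'a::idom set \<Rightarrow> 'a \<Rightarrow> 'a set"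
  where "loc_power_inter Q p = {x. \<forall>n. \<exists>s. s \<notin> Q \<and> p ^ n dvd s * x}"

definition loc_radical :: "'a::idom set \<Rightarrow> 'a \<Rightarrow> 'a set"
  where "loc_radical Q p = {x. \<exists>n s. s \<notin> Q \<and> p dvd s * x ^ n}"

context
  fixes Q :: "'a::idom set" and p :: 'a
  assumes pr: "prufer_domain TYPE('a)" and Q: "Q \<in> spec" and p: "p \<in> Q"
begin

text \<open>Cancelling \<open>p\<close> in \<open>p ^ 2 dvd s * p\<close> would make
  \<open>p\<close> divide \<open>s\<close> and put \<open>s\<close> into \<open>Q\<close>.\<close>

lemma p_notin_loc_power_inter:
  assumes "p \<noteq> 0"
  shows "p \<notin> loc_power_inter Q p"
proof
  assume "p \<in> loc_power_inter Q p"
  then obtain s where "s \<notin> Q" "p ^ 2 dvd s * p" unfolding loc_power_inter_def by blast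
  then show False using assms spec_dvd[OF Q p, of s] by (auto simp: power2_eq_square)
qed

text \<open>In D_Q each \<open>x\<close> in \<open>L\<close> is comparable with each power of
  \<open>p\<close>. If \<open>x\<close> divided \<open>s * p ^ n\<close> with \<open>s\<close>
  outside \<open>Q\<close>, this product would lie in the prime \<open>L\<close>, which contains
  neither factor.\<close>

lemma prime_subset_loc_power_inter:
  assumes L: "L \<in> spec" "L \<subseteq> Q" "p \<notin> L"
  shows "L \<subseteq> loc_power_inter Q p"
proof
  fix x assume x: "x \<in> L"
  show "x \<in> loc_power_inter Q p" unfolding loc_power_inter_def
  proof (intro CollectI allI)
    fix n
    obtain s where s: "s \<notin> Q" "p ^ n dvd s * x \<or> x dvd s * p ^ n"
      using prufer_compare[OF pr Q] by blast
    moreover have "s * p ^ n \<notin> L"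
      using s(1) L spec_mult[OF L(1)] spec_power[OF L(1)] by blast
    ultimately show "\<exists>s. s \<notin> Q \<and> p ^ n dvd s * x" using spec_dvd[OF L(1) x] by blast
  qed
qed

lemma loc_power_inter_in_spec:
  assumes "p \<noteq> 0"
  shows "loc_power_inter Q p \<in> spec"
  unfolding spec_iff ideal_dom_ring_iff
proof (intro conjI ballI allI impI)
  show "0 \<in> loc_power_inter Q p" unfolding loc_power_inter_def using spec_1[OF Q] by auto
next
  fix x y assume xy: "x \<in> loc_power_inter Q p" "y \<in> loc_power_inter Q p"
  show "x + y \<in> loc_power_inter Q p" unfolding loc_power_inter_def
  proof (intro CollectI allI)
    fix n
    obtain s t where st: "s \<notin> Q" "p ^ n dvd s * x" "t \<notin> Q" "p ^ n dvd t * y"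
      using xy unfolding loc_power_inter_def by blast
    have "s * t * (x + y) = t * (s * x) + s * (t * y)" by (simp add: algebra_simps)
    then have "p ^ n dvd s * t * (x + y)" using st by simp
    then show "\<exists>s. s \<notin> Q \<and> p ^ n dvd s * (x + y)" using st spec_mult[OF Q] by blast
  qed
next
  fix x r assume x: "x \<in> loc_power_inter Q p"
  show "r * x \<in> loc_power_inter Q p" unfolding loc_power_inter_def
  proof (intro CollectI allI)
    fix n
    obtain s where "s \<notin> Q" "p ^ n dvd s * x" using x unfolding loc_power_inter_def by blast
    then show "\<exists>s. s \<notin> Q \<and> p ^ n dvd s * (r * x)" by (metis dvd_mult mult.left_commute)
  qed
next
  show "1 \<notin> loc_power_inter Q p"
    unfolding loc_power_inter_def using spec_dvd[OF Q p]
    by (auto intro!: exI[of _ 1])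
next
  fix x y assume xy: "x * y \<in> loc_power_inter Q p"
  \<comment> \<open>By comparability, an element outside the intersection divides some power of
    \<open>p\<close> in D_Q.\<close>
  have nu: "\<exists>n s. s \<notin> Q \<and> z dvd s * p ^ n" if "z \<notin> loc_power_inter Q p" for z
    using that prufer_compare[OF pr Q] unfolding loc_power_inter_def by blast
  show "x \<in> loc_power_inter Q p \<or> y \<in> loc_power_inter Q p"
  proof (rule ccontr)
    assume "\<not> ?thesis"
    then obtain n s m t where st: "s \<notin> Q" "x dvd s * p ^ n" "t \<notin> Q" "y dvd t * p ^ m"
      using nu by meson
    \<comment> \<open>The exponent exceeds \<open>n + m\<close> by one: cancelling leaves a factor
      \<open>p\<close>, which would divide a product of elements outside \<open>Q\<close>.\<close>
    obtain u where u: "u \<notin> Q" "p ^ (n + m + 1) dvd u * (x * y)"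
      using xy unfolding loc_power_inter_def by blast
    have "u * (x * y) dvd u * ((s * p ^ n) * (t * p ^ m))"
      using st by (intro mult_dvd_mono) simp_all
    with u(2) have "p ^ (n + m + 1) dvd u * ((s * p ^ n) * (t * p ^ m))"
      by (rule dvd_trans)
    moreover have "p ^ (n + m + 1) = p ^ (n + m) * p" by simp
    moreover have "u * ((s * p ^ n) * (t * p ^ m)) = p ^ (n + m) * (u * s * t)"
      by (simp add: power_add mult_ac)
    ultimately have "p ^ (n + m) * p dvd p ^ (n + m) * (u * s * t)" by (simp only:)
    then have "p dvd u * s * t" using assms by (simp only: dvd_mult_cancel_left power_eq_0_iff) simp
    then have "u * s * t \<in> Q" by (rule spec_dvd[OF Q p])
    then show False using u st by (simp add: spec_mult[OF Q])
  qed
qed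

lemma loc_power_inter_subset_loc_radical: "loc_power_inter Q p \<subseteq> loc_radical Q p"
proof
  fix x assume "x \<in> loc_power_inter Q p"
  then obtain s where "s \<notin> Q" "p ^ 1 dvd s * x" unfolding loc_power_inter_def by blast
  then have "s \<notin> Q \<and> p dvd s * x ^ 1" by simp
  then show "x \<in> loc_radical Q p" unfolding loc_radical_def by blast
qed

lemma loc_radical_subset: "loc_radical Q p \<subseteq> Q"
proof
  fix x assume "x \<in> loc_radical Q p"
  then obtain n s where s: "s \<notin> Q" "p dvd s * x ^ n" unfolding loc_radical_def by blast
  then show "x \<in> Q" using spec_dvd[OF Q p] spec_mult[OF Q] spec_powerD[OF Q] by blast
qed

lemma loc_radical_subset_prime:
  assumes L: "L \<in> spec" "L \<subseteq> Q" "p \<in> L"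
  shows "loc_radical Q p \<subseteq> L"
proof
  fix x assume "x \<in> loc_radical Q p"
  then obtain n s where s: "s \<notin> Q" "p dvd s * x ^ n" unfolding loc_radical_def by blast
  then show "x \<in> L" using spec_dvd[OF L(1,3)] spec_mult[OF L(1)] spec_powerD[OF L(1)] L(2) by blast
qed

lemma loc_radicalI: "s \<notin> Q \<Longrightarrow> p dvd s * x \<Longrightarrow> x \<in> loc_radical Q p"
  unfolding loc_radical_def by (intro CollectI exI[of _ 1] exI[of _ s]) simp

text \<open>The radical of a proper ideal in a valuation ring is prime: whichever of
  \<open>x\<close> and \<open>y\<close> divides the other in D_Q also divides the sum, and
  \<open>x * y\<close> divides the square of the other one.\<close>

lemma loc_radical_in_spec: "loc_radical Q p \<in> spec"
  unfolding spec_iff ideal_dom_ring_iff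
proof (intro conjI ballI allI impI)
  show "0 \<in> loc_radical Q p" by (rule loc_radicalI[OF spec_1[OF Q]]) simp
next
  fix x y
  have add: "u + v \<in> loc_radical Q p"
    if u: "u \<in> loc_radical Q p" and t: "t \<notin> Q" "u dvd t * v" for u v t
  proof -
    obtain n s where s: "s \<notin> Q" "p dvd s * u ^ n" using u unfolding loc_radical_def by blast
    have "u dvd t * (u + v)" using t by (simp add: distrib_left)
    then have "s * u ^ n dvd s * (t * (u + v)) ^ n" by (intro mult_dvd_mono dvd_power_same) simp_all
    then have "p dvd (s * t ^ n) * (u + v) ^ n"
      using s(2) by (metis dvd_trans mult.assoc power_mult_distrib)
    then show ?thesis
      unfolding loc_radical_def using s t spec_mult[OF Q] spec_power[OF Q] by blast
  qed
  assume "x \<in> loc_radical Q p" "y \<in> loc_radical Q p"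
  then show "x + y \<in> loc_radical Q p"
    using add prufer_compare[OF pr Q, of x y] by (metis add.commute)
next
  fix x r assume "x \<in> loc_radical Q p"
  then obtain n s where s: "s \<notin> Q" "p dvd s * x ^ n" unfolding loc_radical_def by blast
  then have "p dvd s * (r * x) ^ n" by (metis dvd_mult mult.left_commute power_mult_distrib)
  then show "r * x \<in> loc_radical Q p" using s unfolding loc_radical_def by blast
next
  show "1 \<notin> loc_radical Q p" using loc_radical_subset spec_1[OF Q] by blast
next
  fix x y assume xy: "x * y \<in> loc_radical Q p"
  have *: "v \<in> loc_radical Q p"
    if uv: "u * v \<in> loc_radical Q p" and t: "t \<notin> Q" "u dvd t * v" for u v t
  proof -
    obtain n s where s: "s \<notin> Q" "p dvd s * (u * v) ^ n"
      using uv unfolding loc_radical_def by blast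
    have "s * (u * v) ^ n dvd s * ((t * v) * v) ^ n"
      using t by (intro mult_dvd_mono dvd_power_same) simp_all
    then have "p dvd (s * t ^ n) * v ^ (2 * n)"
      using s(2) by (metis dvd_trans mult.assoc power_mult power_mult_distrib power2_eq_square)
    then show ?thesis
      unfolding loc_radical_def using s t spec_mult[OF Q] spec_power[OF Q] by blast
  qed
  show "x \<in> loc_radical Q p \<or> y \<in> loc_radical Q p"
    using xy prufer_compare[OF pr Q, of x y] * by (metis mult.commute)
qed

text \<open>A prime \<open>L\<close> below \<open>loc_radical Q p\<close> lies in \<open>Q\<close>.
  If it contains \<open>p\<close>, it contains \<open>loc_radical Q p\<close>; otherwise it lies
  inside \<open>loc_power_inter Q p\<close>.\<close>

lemma loc_power_inter_loc_radical_adjacent: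
  assumes "L \<in> spec"
  shows "\<not> (loc_power_inter Q p \<subset> L \<and> L \<subset> loc_radical Q p)"
  using assms prime_subset_loc_power_inter loc_radical_subset_prime loc_radical_subset by blast

end

section \<open>Rim elements of V(F)\<close>

context
  fixes Q :: "'a::idom set" and F :: "'a set" and f s :: 'a
  assumes pr: "prufer_domain TYPE('a)" and Q: "Q \<in> zariski_closed F"
    and f: "f \<in> F" "f \<noteq> 0" and s: "s \<notin> Q" "\<And>g. g \<in> F \<Longrightarrow> f dvd s * g"
begin

text \<open>\<open>Q\<close> itself may fail to be adjacent to \<open>loc_power_inter Q f\<close>.
  The member of V(F) directly above it is \<open>loc_radical Q f\<close>, which contains
  \<open>F\<close> since \<open>f\<close> divides every element of \<open>F\<close> up to the factor
  \<open>s\<close>.\<close>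

lemma rim_element_loc_power_inter: "rim_element (zariski_closed F) (loc_power_inter Q f)"
proof -
  have Q': "Q \<in> spec" "f \<in> Q" using Q f unfolding zariski_closed_def by auto
  have "F \<subseteq> loc_radical Q f" using loc_radicalI[OF pr Q'] s by blast
  then have "loc_radical Q f \<in> zariski_closed F"
    using loc_radical_in_spec[OF pr Q'] by (simp add: zariski_closed_def)
  moreover have "loc_power_inter Q f \<notin> zariski_closed F"
    using p_notin_loc_power_inter[OF pr Q' f(2)] f(1) unfolding zariski_closed_def by blast
  ultimately show ?thesis unfolding rim_element_def
    using loc_power_inter_in_spec[OF pr Q' f(2)] loc_power_inter_subset_loc_radical[OF pr Q']
      loc_power_inter_loc_radical_adjacent[OF pr Q'] by blast
qed

text \<open>\<open>R\<close> misses \<open>f\<close>: otherwise \<open>s * g\<close> would lie in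
  \<open>R\<close> for all \<open>g\<close> in \<open>F\<close>, and then so would \<open>g\<close>,
  as \<open>s\<close> is outside \<open>Q\<close>. So \<open>R\<close> lies in
  \<open>loc_power_inter Q f\<close>, a prime strictly inside \<open>Q\<close>, and adjacency forces
  equality.\<close>

lemma loc_power_inter_subset_rim:
  assumes R: "R \<in> spec" "R \<notin> zariski_closed F" "R \<subseteq> Q"
    and adj: "\<not> (\<exists>L\<in>spec. R \<subset> L \<and> L \<subset> Q)"
  shows "loc_power_inter Q f \<subseteq> R"
proof -
  have Q': "Q \<in> spec" "f \<in> Q" using Q f unfolding zariski_closed_def by auto
  obtain g where g: "g \<in> F" "g \<notin> R" using R unfolding zariski_closed_def by auto
  have "f \<notin> R"
    using spec_dvd[OF R(1) _ s(2)[OF g(1)]] spec_mult[OF R(1)] g(2) s(1) R(3) by blast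
  then have "R \<subseteq> loc_power_inter Q f" by (rule prime_subset_loc_power_inter[OF pr Q' R(1,3)])
  moreover have "loc_power_inter Q f \<subset> Q"
    using p_notin_loc_power_inter[OF pr Q' f(2)] Q'(2) loc_power_inter_subset_loc_radical[OF pr Q']
      loc_radical_subset[OF pr Q'] by blast
  ultimately show ?thesis using adj loc_power_inter_in_spec[OF pr Q' f(2)] by blast
qed

end

section \<open>The complete integral closure and the extension of P to it\<close>

lemma one_in_cic: "1 \<in> (complete_integral_closure :: 'a::idom fract set)"
  and cic_add: "x \<in> complete_integral_closure \<Longrightarrow> y \<in> complete_integral_closure \<Longrightarrow>
    x + y \<in> (complete_integral_closure :: 'a::idom fract set)"
  and cic_mult: "x \<in> complete_integral_closure \<Longrightarrow> y \<in> complete_integral_closure \<Longrightarrow>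
    x * y \<in> (complete_integral_closure :: 'a::idom fract set)"
  using subringE(3,6,7)[OF subring_complete_integral_closure[where 'a='a]] by auto

lemma to_fract_power [simp]: "to_fract (a ^ n) = to_fract a ^ n"
  by (induction n) simp_all

lemma to_fract_in_cic: "to_fract a \<in> (complete_integral_closure :: 'a::idom fract set)"
proof -
  have "to_fract 1 * to_fract a ^ n \<in> range to_fract" for n
    by (simp flip: to_fract_power del: to_fract_power)
  then show ?thesis unfolding complete_integral_closure_def almost_integral_def
    by (intro CollectI exI[of _ 1]) simp
qed

lemma ring_cic_ring: "ring (cic_ring :: 'a::idom fract ring)"
  by (rule ring.subring_is_ring[OF ring_from_type_algebra subring_complete_integral_closure])

lemma ideal_cic_ringI:
  fixes E :: "'a::idom fract set"
  assumes E: "E \<subseteq> complete_integral_closure" "0 \<in> E"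
    "\<And>x y. x \<in> E \<Longrightarrow> y \<in> E \<Longrightarrow> x + y \<in> E"
    "\<And>x r. x \<in> E \<Longrightarrow> r \<in> complete_integral_closure \<Longrightarrow> r * x \<in> E"
  shows "ideal E cic_ring"
proof (rule idealI[OF ring_cic_ring])
  have neg: "- x \<in> E" if "x \<in> E" for x
    using E(4)[OF that to_fract_in_cic[of "- 1"]] by simp
  have inv: "\<ominus>\<^bsub>cic_ring\<^esub> x = - x" if "x \<in> E" for x
    using that neg[OF that] E(1)
    by (intro abelian_group.minus_equality[OF ring.is_abelian_group[OF ring_cic_ring]]) auto
  show "subgroup E (add_monoid cic_ring)"
  proof (rule group.subgroupI)
    show "group (add_monoid (cic_ring :: 'a fract ring))"
      by (rule abelian_group.a_group[OF ring.is_abelian_group[OF ring_cic_ring]])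
    show "inv\<^bsub>add_monoid cic_ring\<^esub> x \<in> E" if "x \<in> E" for x
      using neg[OF that] inv[OF that] unfolding a_inv_def by simp
  qed (use E in auto)
qed (use E in \<open>auto simp: mult.commute\<close>)

text \<open>An ideal is the whole ring iff it contains 1. The finite sums form an ideal
  \<open>E\<close> that contains \<open>P\<close> and hence its extension; with lists of pairs,
  adding two sums is concatenation.\<close>

lemma cic_extension_eq_cic_iff:
  fixes P :: "'a::idom set"
  shows "cic_extension P = complete_integral_closure \<longleftrightarrow>
    (\<exists>ps. set ps \<subseteq> P \<times> complete_integral_closure \<and> (\<Sum>(p, z)\<leftarrow>ps. to_fract p * z) = 1)"
proof
  define E where "E = {\<Sum>(p, z)\<leftarrow>ps. to_fract p * z | ps.
    set ps \<subseteq> P \<times> (complete_integral_closure :: 'a fract set)}"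
  have mem: "(\<Sum>(p, z)\<leftarrow>ps. to_fract p * z) \<in> E"
    if "set ps \<subseteq> P \<times> complete_integral_closure" for ps
    using that E_def by blast
  have "ideal E cic_ring"
  proof (rule ideal_cic_ringI)
    have "(\<Sum>(p, z)\<leftarrow>ps. to_fract p * z) \<in> complete_integral_closure"
      if "set ps \<subseteq> P \<times> complete_integral_closure" for ps
      using that to_fract_in_cic[of 0]
      by (induction ps) (auto intro!: cic_add cic_mult to_fract_in_cic)
    then show "E \<subseteq> complete_integral_closure" unfolding E_def by blast
    show "0 \<in> E" using mem[of "[]"] by simp
  next
    fix x y assume "x \<in> E" "y \<in> E"
    then obtain ps qs where "x = (\<Sum>(p, z)\<leftarrow>ps. to_fract p * z)" "y = (\<Sum>(p, z)\<leftarrow>qs. to_fract p * z)"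
      "set ps \<subseteq> P \<times> complete_integral_closure" "set qs \<subseteq> P \<times> complete_integral_closure"
      unfolding E_def by blast
    then show "x + y \<in> E" using mem[of "ps @ qs"] by simp
  next
    fix x and r :: "'a fract" assume "x \<in> E" and r: "r \<in> complete_integral_closure"
    then obtain ps where ps: "x = (\<Sum>(p, z)\<leftarrow>ps. to_fract p * z)"
      "set ps \<subseteq> P \<times> complete_integral_closure" unfolding E_def by blast
    have "r * (\<Sum>(p, z)\<leftarrow>ps. to_fract p * z) =
        (\<Sum>(p, z)\<leftarrow>map (\<lambda>(p, z). (p, r * z)) ps. to_fract p * z)"
      by (induction ps) (auto simp: algebra_simps)
    moreover have "set (map (\<lambda>(p, z). (p, r * z)) ps) \<subseteq> P \<times> complete_integral_closure"
      using ps(2) r by (auto intro: cic_mult)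
    ultimately show "r * x \<in> E" using mem ps(1) by metis
  qed
  moreover have "to_fract ` P \<subseteq> E" using mem[of "[(p, 1)]" for p] one_in_cic by auto
  ultimately have "cic_extension P \<subseteq> E"
    unfolding cic_extension_def by (rule ring.genideal_minimal[OF ring_cic_ring])
  moreover assume "cic_extension P = complete_integral_closure"
  ultimately have "1 \<in> E" using one_in_cic by blast
  then show "\<exists>ps. set ps \<subseteq> P \<times> complete_integral_closure \<and> (\<Sum>(p, z)\<leftarrow>ps. to_fract p * z) = 1"
    unfolding E_def by auto
next
  assume "\<exists>ps. set ps \<subseteq> P \<times> complete_integral_closure \<and> (\<Sum>(p, z)\<leftarrow>ps. to_fract p * z) = 1"
  then obtain ps where ps: "set ps \<subseteq> P \<times> complete_integral_closure"
    "(\<Sum>(p, z)\<leftarrow>ps. to_fract p * z) = 1" by blast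
  have img: "to_fract ` P \<subseteq> carrier (cic_ring :: 'a fract ring)" using to_fract_in_cic by auto
  have id: "ideal (cic_extension P) cic_ring" and sub: "to_fract ` P \<subseteq> cic_extension P"
    unfolding cic_extension_def
    using ring.genideal_ideal[OF ring_cic_ring img] ring.genideal_self[OF ring_cic_ring img] by auto
  have "(\<Sum>(p, z)\<leftarrow>ps. to_fract p * z) \<in> cic_extension P"
    using ps(1)
  proof (induction ps)
    case Nil
    then show ?case using additive_subgroup.zero_closed[OF ideal.axioms(1)[OF id]] by simp
  next
    case (Cons a ps)
    obtain p z where a: "a = (p, z)" by force
    have "to_fract p * z \<in> cic_extension P"
      using ideal.I_r_closed[OF id, of "to_fract p" z] sub Cons.prems a by auto
    then show ?case
      using Cons a additive_subgroup.a_closed[OF ideal.axioms(1)[OF id]] by auto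
  qed
  then have "\<one>\<^bsub>cic_ring\<^esub> \<in> cic_extension P" using ps(2) by simp
  from ideal.one_imp_carrier[OF id this] show "cic_extension P = complete_integral_closure" by simp
qed

lemma sum_closed:
  assumes "0 \<in> B" "\<And>x y. x \<in> B \<Longrightarrow> y \<in> B \<Longrightarrow> x + y \<in> B" "\<And>i. i \<in> A \<Longrightarrow> f i \<in> B"
  shows "sum f A \<in> B"
  using assms(3) by (induction A rule: infinite_finite_induct) (auto intro: assms)

text \<open>The set \<open>B\<close> stands for the \<open>D\<close>-algebra generated by \<open>Z\<close>, so that \<open>c\<close> is a common denominator of all
  monomials in elements of \<open>Z\<close>.\<close>

lemma finite_cic_common_denominator:
  fixes Z :: "'a::idom fract set"
  assumes "finite Z" "Z \<subseteq> complete_integral_closure"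
  shows "\<exists>B c. c \<noteq> 0 \<and> range to_fract \<subseteq> B \<and> Z \<subseteq> B \<and>
    (\<forall>x\<in>B. \<forall>y\<in>B. x + y \<in> B \<and> x * y \<in> B) \<and> (\<forall>b\<in>B. to_fract c * b \<in> range to_fract)"
  using assms
proof (induction rule: finite_induct)
  case empty
  then show ?case
    using rangeI[of to_fract 1]
    by (intro exI[of _ "range to_fract"] exI[of _ 1] conjI ballI range_to_fract_closed) auto
next
  case (insert z Z)
  from insert.prems have "Z \<subseteq> complete_integral_closure" by simp
  from insert.IH[OF this] obtain B c where "c \<noteq> 0" "range to_fract \<subseteq> B" "Z \<subseteq> B"
      "\<forall>x\<in>B. \<forall>y\<in>B. x + y \<in> B \<and> x * y \<in> B" "\<forall>b\<in>B. to_fract c * b \<in> range to_fract"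
    by (elim exE conjE) (rule that)
  then have B: "c \<noteq> 0" "range to_fract \<subseteq> B" "Z \<subseteq> B"
      "\<And>x y. x \<in> B \<Longrightarrow> y \<in> B \<Longrightarrow> x + y \<in> B" "\<And>x y. x \<in> B \<Longrightarrow> y \<in> B \<Longrightarrow> x * y \<in> B"
      "\<And>b. b \<in> B \<Longrightarrow> to_fract c * b \<in> range to_fract"
    by simp_all
  \<comment> \<open>\<open>d\<close> clears every power of \<open>z\<close>, including the zeroth
    one that goes with constant coefficients.\<close>
  obtain d where d: "d \<noteq> 0" "\<And>n. to_fract d * z ^ n \<in> range to_fract"
    using insert.prems almost_integralE[of z] unfolding complete_integral_closure_def by blast
  have B0: "0 \<in> B" and B1: "1 \<in> B"
    using B(2) rangeI[of to_fract 0] rangeI[of to_fract 1] by auto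
  \<comment> \<open>\<open>B'\<close> is the ring \<open>B[z]\<close>. In the new denominator
    \<open>c * d\<close>, the factor \<open>c\<close> clears the coefficients and \<open>d\<close>
    the powers of \<open>z\<close>.\<close>
  define B' where "B' = {poly p z | p. \<forall>i. coeff p i \<in> B}"
  have mem: "poly p z \<in> B'" if "\<And>i. coeff p i \<in> B" for p using that B'_def by blast
  have const: "B \<subseteq> B'"
  proof
    fix b assume "b \<in> B"
    then show "b \<in> B'" using mem[of "[:b:]"] B0 by (simp add: coeff_pCons split: nat.split)
  qed
  have z: "z \<in> B'"
    using mem[of "[:0, 1:]"] B0 B1 by (simp add: coeff_pCons split: nat.split)
  have "x + y \<in> B' \<and> x * y \<in> B'" if xy: "x \<in> B'" "y \<in> B'" for x y
  proof -
    obtain p q where pq: "x = poly p z" "y = poly q z" "\<And>i. coeff p i \<in> B" "\<And>i. coeff q i \<in> B"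
      using xy unfolding B'_def by blast
    have "coeff (p * q) i \<in> B" for i
      unfolding coeff_mult by (intro sum_closed B0 B(4,5) pq)
    then show ?thesis
      using mem[of "p + q"] mem[of "p * q"] pq B(4) by simp
  qed
  moreover have "to_fract (c * d) * b \<in> range to_fract" if b: "b \<in> B'" for b
  proof -
    obtain p where p: "b = poly p z" "\<And>i. coeff p i \<in> B" using b unfolding B'_def by blast
    have "to_fract (c * d) * b =
        (\<Sum>i\<le>degree p. (to_fract c * coeff p i) * (to_fract d * z ^ i))"
      unfolding p(1) poly_altdef sum_distrib_left by (simp add: algebra_simps)
    also have "\<dots> \<in> range to_fract"
      by (intro sum_closed range_to_fract_closed B(6) p(2) d(2)) (metis rangeI to_fract_0)
    finally show ?thesis .
  qed
  ultimately show ?case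
    using B(1-3) d(1) const z by (intro exI[of _ B'] exI[of _ "c * d"]) auto
qed

section \<open>Rim closures of V(F) with nonzero intersection, and invertible ideals\<close>

lemma zero_notin_zariski_closedD: "{0} \<notin> zariski_closed F \<Longrightarrow> \<exists>g\<in>F. g \<noteq> (0 :: 'a::idom)"
  unfolding zariski_closed_def using zero_in_spec by blast

text \<open>The nonzero \<open>g\<close> keeps the local generator nonzero, since
  \<open>0 dvd s * g\<close> would force \<open>s * g = 0\<close>.\<close>

lemma finite_locally_principalE:
  fixes Q :: "'a::idom set"
  assumes pr: "prufer_domain TYPE('a)" and Q: "Q \<in> spec"
    and F: "finite F" "g \<in> F" "g \<noteq> 0"
  obtains f s where "f \<in> F" "f \<noteq> 0" "s \<notin> Q" "\<And>h. h \<in> F \<Longrightarrow> f dvd s * h"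
proof -
  obtain f s where fs: "f \<in> F" "s \<notin> Q" "\<forall>h\<in>F. f dvd s * h"
    using prufer_locally_principal[OF pr Q F(1)] F(2) by blast
  moreover have "f \<noteq> 0" using fs(3) F(2,3) spec_nonzero[OF Q fs(2)] by auto
  ultimately show thesis using that by blast
qed

text \<open>Let \<open>c\<close> be a common denominator of a ring \<open>B\<close> that contains
  all the \<open>z\<close>. If \<open>f\<close> generates the ideal locally at \<open>Q\<close>,
  then \<open>s = f * w\<close> with \<open>w\<close> in \<open>B\<close>. Hence
  \<open>s ^ n * c = f ^ n * (c * w ^ n)\<close>, where \<open>c * w ^ n\<close> lies in D, so
  \<open>c\<close> lies in every \<open>f ^ n\<close> D_Q.\<close>

lemma extension_eq_imp_Inter_rim_closure_nonzero:
  fixes ps :: "('a::idom \<times> 'a fract) list"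
  assumes pr: "prufer_domain TYPE('a)"
    and ps: "snd ` set ps \<subseteq> complete_integral_closure" "(\<Sum>(p, z)\<leftarrow>ps. to_fract p * z) = 1"
  shows "\<exists>c. c \<noteq> 0 \<and> c \<in> \<Inter>(rim_closure (zariski_closed (fst ` set ps)))"
proof -
  define F where "F = fst ` set ps"
  have "\<exists>g\<in>F. g \<noteq> 0"
  proof (rule ccontr)
    assume "\<not> (\<exists>g\<in>F. g \<noteq> 0)"
    then have "(\<Sum>(p, z)\<leftarrow>ps. to_fract p * z) = 0"
      unfolding F_def by (induction ps) auto
    then show False using ps(2) by simp
  qed
  then obtain g where g: "g \<in> F" "g \<noteq> 0" by blast
  have fin: "finite F" by (simp add: F_def)
  obtain B c where "c \<noteq> 0" "range to_fract \<subseteq> B" "snd ` set ps \<subseteq> B"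
      "\<forall>x\<in>B. \<forall>y\<in>B. x + y \<in> B \<and> x * y \<in> B" "\<forall>b\<in>B. to_fract c * b \<in> range to_fract"
    using finite_cic_common_denominator[OF finite_imageI[OF List.finite_set] ps(1)]
    by (elim exE conjE) (rule that)
  then have B: "c \<noteq> 0" "range to_fract \<subseteq> B" "snd ` set ps \<subseteq> B"
      "\<And>x y. x \<in> B \<Longrightarrow> y \<in> B \<Longrightarrow> x + y \<in> B" "\<And>x y. x \<in> B \<Longrightarrow> y \<in> B \<Longrightarrow> x * y \<in> B"
      "\<And>b. b \<in> B \<Longrightarrow> to_fract c * b \<in> range to_fract"
    by simp_all
  have B0: "0 \<in> B" and B1: "1 \<in> B"
    using B(2) rangeI[of to_fract 0] rangeI[of to_fract 1] by auto
  have c: "c \<in> loc_power_inter Q f"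
    if s: "s \<notin> Q" "\<And>h. h \<in> F \<Longrightarrow> f dvd s * h" and Q: "Q \<in> spec" for Q f s
  proof -
    \<comment> \<open>Each \<open>s * p\<close> is a multiple of \<open>f\<close>, so
      \<open>s\<close> times such a sum is \<open>f\<close> times an element of \<open>B\<close>;
      for \<open>ps\<close> the sum is 1.\<close>
    have "\<exists>w\<in>B. to_fract s * (\<Sum>(p, z)\<leftarrow>qs. to_fract p * z) = to_fract f * w"
      if "set qs \<subseteq> set ps" for qs
      using that
    proof (induction qs)
      case Nil
      then show ?case using B0 by auto
    next
      case (Cons a qs)
      obtain p z where a: "a = (p, z)" by force
      obtain w where w: "w \<in> B" "to_fract s * (\<Sum>(p, z)\<leftarrow>qs. to_fract p * z) = to_fract f * w"
        using Cons by auto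
      have pz: "p \<in> F" "z \<in> B" using Cons.prems a B(3) unfolding F_def by force+
      obtain r where "s * p = f * r" using s(2)[OF pz(1)] by (elim dvdE)
      then have "to_fract s * to_fract p = to_fract f * to_fract r" by (metis to_fract_mult)
      then have "to_fract s * (\<Sum>(p, z)\<leftarrow>a # qs. to_fract p * z) = to_fract f * (to_fract r * z + w)"
        using w(2) a by (simp add: algebra_simps)
      moreover have "to_fract r * z + w \<in> B" using B w pz by blast
      ultimately show ?case by blast
    qed
    from this[of ps] obtain w where w: "w \<in> B" "to_fract s = to_fract f * w"
      using ps(2) by auto
    show ?thesis unfolding loc_power_inter_def
    proof (intro CollectI allI)
      fix n
      have "w ^ n \<in> B" by (induction n) (auto intro: B B1 w)
      then obtain d where d: "to_fract c * w ^ n = to_fract d" using B(6) by blast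
      have "to_fract (s ^ n * c) = to_fract (f ^ n * d)"
        using w(2) d by (simp add: power_mult_distrib flip: d)
      then have "s ^ n * c = f ^ n * d" by (simp only: to_fract_eq_iff)
      then show "\<exists>s. s \<notin> Q \<and> f ^ n dvd s * c" using spec_power[OF Q s(1)] by (metis dvd_triv_left)
    qed
  qed
  have "c \<in> R" if "R \<in> rim_closure (zariski_closed F)" for R
    using that unfolding rim_closure_def
  proof
    \<comment> \<open>Here \<open>R\<close> itself serves as \<open>Q\<close>, and
      \<open>loc_power_inter R f\<close> lies inside \<open>R\<close>.\<close>
    assume R: "R \<in> zariski_closed F"
    then have R': "R \<in> spec" "F \<subseteq> R" by (auto simp: zariski_closed_def)
    obtain f s where fs: "f \<in> F" "f \<noteq> 0" "s \<notin> R" "\<And>h. h \<in> F \<Longrightarrow> f dvd s * h"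
      using finite_locally_principalE[OF pr R'(1) fin g] by metis
    have "f \<in> R" using fs(1) R' by blast
    then show "c \<in> R"
      using c[OF fs(3,4) R'(1)] loc_power_inter_subset_loc_radical[OF pr R'(1)]
        loc_radical_subset[OF pr R'(1)] by blast
  next
    assume "R \<in> {R. rim_element (zariski_closed F) R}"
    then obtain Q where R: "R \<in> spec" "R \<notin> zariski_closed F" "R \<subseteq> Q"
      and Q: "Q \<in> zariski_closed F" and adj: "\<not> (\<exists>L\<in>spec. R \<subset> L \<and> L \<subset> Q)"
      unfolding rim_element_def by blast
    have Q': "Q \<in> spec" using Q by (simp add: zariski_closed_def)
    obtain f s where fs: "f \<in> F" "f \<noteq> 0" "s \<notin> Q" "\<And>h. h \<in> F \<Longrightarrow> f dvd s * h"
      using finite_locally_principalE[OF pr Q' fin g] by metis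
    show "c \<in> R"
      using c[OF fs(3,4) Q'] loc_power_inter_subset_rim[OF pr Q fs R adj] by blast
  qed
  then show ?thesis using B(1) unfolding F_def by blast
qed

text \<open>That \<open>c * x ^ n\<close> lies in D is checked at each prime \<open>Q\<close>. If
  \<open>F\<close> lies in \<open>Q\<close>, the rim element below \<open>Q\<close> contains
  \<open>c\<close>, so \<open>c\<close> is in \<open>f ^ n\<close> D_Q, and \<open>f * x\<close> is
  in D. Otherwise some \<open>f\<close> in \<open>F\<close> is a unit of D_Q, and \<open>x\<close>
  itself lies in D_Q.\<close>

lemma inverse_ideal_almost_integral:
  fixes F :: "'a::idom set"
  assumes pr: "prufer_domain TYPE('a)" and F: "finite F" "g \<in> F" "g \<noteq> 0"
    and c: "c \<noteq> 0" "c \<in> \<Inter>(rim_closure (zariski_closed F))"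
    and x: "\<And>h. h \<in> F \<Longrightarrow> to_fract h * x \<in> range to_fract"
  shows "almost_integral x"
proof -
  have "to_fract c * x ^ n \<in> range to_fract" for n
  proof -
    \<comment> \<open>\<open>A\<close> is the ideal of denominators of \<open>c * x ^ n\<close>;
      once no prime contains it, 1 belongs to it.\<close>
    define A where "A = {a. to_fract (a * c) * x ^ n \<in> range to_fract}"
    have "ideal A dom_ring" unfolding ideal_dom_ring_iff
    proof (intro conjI ballI allI)
      show "0 \<in> A" unfolding A_def using rangeI[of to_fract 0] by simp
    next
      fix a b assume "a \<in> A" "b \<in> A"
      then show "a + b \<in> A" unfolding A_def
        using range_to_fract_closed(1)[of "to_fract (a * c) * x ^ n" "to_fract (b * c) * x ^ n"]
        by (simp add: algebra_simps)
    next
      fix a r assume "a \<in> A"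
      then show "r * a \<in> A" unfolding A_def
        using range_to_fract_closed(2)[of "to_fract r" "to_fract (a * c) * x ^ n"]
        by (simp add: algebra_simps)
    qed
    moreover have "\<not> A \<subseteq> Q" if Q: "Q \<in> spec" for Q
    proof (cases "F \<subseteq> Q")
      case True
      then have QF: "Q \<in> zariski_closed F" using Q by (simp add: zariski_closed_def)
      obtain f s where fs: "f \<in> F" "f \<noteq> 0" "s \<notin> Q" "\<And>h. h \<in> F \<Longrightarrow> f dvd s * h"
        using finite_locally_principalE[OF pr Q F] by metis
      have "c \<in> loc_power_inter Q f"
        using c(2) rim_element_loc_power_inter[OF pr QF fs] unfolding rim_closure_def by blast
      then obtain t where t: "t \<notin> Q" "f ^ n dvd t * c" unfolding loc_power_inter_def by blast
      then obtain d where d: "t * c = f ^ n * d" by (elim dvdE)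
      obtain e where e: "to_fract f * x = to_fract e" using x[OF fs(1)] by blast
      have "to_fract (t * c) * x ^ n = to_fract d * (to_fract f * x) ^ n"
        unfolding d by (simp add: power_mult_distrib mult_ac)
      also have "\<dots> = to_fract (d * e ^ n)" unfolding e by simp
      finally have "t \<in> A" unfolding A_def by blast
      then show ?thesis using t(1) by blast
    next
      case False
      then obtain f where f: "f \<in> F" "f \<notin> Q" by blast
      obtain e where e: "to_fract f * x = to_fract e" using x[OF f(1)] by blast
      have "to_fract (f ^ n * c) * x ^ n = to_fract c * (to_fract f * x) ^ n"
        by (simp add: power_mult_distrib mult_ac)
      also have "\<dots> = to_fract (c * e ^ n)" unfolding e by simp
      finally have "f ^ n \<in> A" unfolding A_def by blast
      then show ?thesis using spec_power[OF Q f(2)] by blast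
    qed
    ultimately have "1 \<in> A" using exists_prime_above by blast
    then show ?thesis unfolding A_def by simp
  qed
  then show ?thesis using c(1) unfolding almost_integral_def by blast
qed

text \<open>At each prime \<open>Q\<close> the fraction \<open>s / f\<close> lies in the inverse
  ideal, and \<open>s = f * (s / f)\<close>. So the product of the ideal with its inverse has an
  element outside each prime and therefore contains 1.\<close>

lemma prufer_invertible:
  fixes F :: "'a::idom set"
  assumes pr: "prufer_domain TYPE('a)" and F: "finite F" "g \<in> F" "g \<noteq> 0"
  shows "\<exists>ps. set ps \<subseteq> F \<times> {x. \<forall>h\<in>F. to_fract h * x \<in> range to_fract} \<and>
    (\<Sum>(p, z)\<leftarrow>ps. to_fract p * z) = 1"
proof -
  define I where "I = {x. \<forall>h\<in>F. to_fract h * x \<in> range to_fract}"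
  \<comment> \<open>\<open>A\<close> is the product of the ideal generated by \<open>F\<close> with
    its inverse \<open>I\<close>, read inside D.\<close>
  define A where "A = {a. \<exists>ps. set ps \<subseteq> F \<times> I \<and> (\<Sum>(p, z)\<leftarrow>ps. to_fract p * z) = to_fract a}"
  have "ideal A dom_ring" unfolding ideal_dom_ring_iff
  proof (intro conjI ballI allI)
    show "0 \<in> A" unfolding A_def by (auto intro!: exI[of _ "[]"])
  next
    fix a b assume "a \<in> A" "b \<in> A"
    then obtain ps qs where "set ps \<subseteq> F \<times> I" "(\<Sum>(p, z)\<leftarrow>ps. to_fract p * z) = to_fract a"
      "set qs \<subseteq> F \<times> I" "(\<Sum>(p, z)\<leftarrow>qs. to_fract p * z) = to_fract b"
      unfolding A_def by blast
    then show "a + b \<in> A" unfolding A_def by (intro CollectI exI[of _ "ps @ qs"]) simp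
  next
    fix a r assume "a \<in> A"
    then obtain ps where ps: "set ps \<subseteq> F \<times> I" "(\<Sum>(p, z)\<leftarrow>ps. to_fract p * z) = to_fract a"
      unfolding A_def by blast
    have "(\<Sum>(p, z)\<leftarrow>map (\<lambda>(p, z). (p, to_fract r * z)) ps. to_fract p * z) =
        to_fract r * (\<Sum>(p, z)\<leftarrow>ps. to_fract p * z)"
      by (induction ps) (auto simp: algebra_simps)
    moreover have "to_fract r * z \<in> I" if "z \<in> I" for z
      unfolding I_def
    proof (intro CollectI ballI)
      fix h assume "h \<in> F"
      then have "to_fract h * z \<in> range to_fract" using that I_def by blast
      from range_to_fract_closed(2)[OF rangeI[of to_fract r] this]
      show "to_fract h * (to_fract r * z) \<in> range to_fract" by (simp add: mult_ac)
    qed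
    then have "set (map (\<lambda>(p, z). (p, to_fract r * z)) ps) \<subseteq> F \<times> I" using ps(1) by auto
    ultimately show "r * a \<in> A" unfolding A_def using ps(2)
      by (metis (mono_tags, lifting) mem_Collect_eq to_fract_mult)
  qed
  moreover have "\<not> A \<subseteq> Q" if Q: "Q \<in> spec" for Q
  proof -
    obtain f s where fs: "f \<in> F" "f \<noteq> 0" "s \<notin> Q" "\<And>h. h \<in> F \<Longrightarrow> f dvd s * h"
      using finite_locally_principalE[OF pr Q F] by metis
    have "to_fract s / to_fract f \<in> I" unfolding I_def
    proof (intro CollectI ballI)
      fix h assume "h \<in> F"
      then obtain r where "s * h = f * r" using fs(4) by (meson dvdE)
      then have "to_fract s * to_fract h = to_fract f * to_fract r" by (metis to_fract_mult)
      then have "to_fract h * (to_fract s / to_fract f) = to_fract r"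
        using fs(2) by (simp add: field_simps)
      then show "to_fract h * (to_fract s / to_fract f) \<in> range to_fract" by simp
    qed
    then have "s \<in> A" unfolding A_def using fs(1,2)
      by (intro CollectI exI[of _ "[(f, to_fract s / to_fract f)]"]) simp
    then show ?thesis using fs(3) by blast
  qed
  ultimately have "1 \<in> A" using exists_prime_above by blast
  then show ?thesis unfolding A_def I_def by simp
qed

theorem theorem2p8:
  fixes P :: "'a::idom set"
  assumes "prufer_domain TYPE('a)"
    and "P \<in> spec"
  shows "P \<in> spec_star \<longleftrightarrow>
    (\<forall>C. closedin zariski C \<and> cocompact C \<and> P \<in> C \<longrightarrow>
      zariski closure_of (rim_closure C) = spec)"
proof -
  have dense: "zariski closure_of (rim_closure (zariski_closed F)) = spec \<longleftrightarrow>
      \<Inter>(rim_closure (zariski_closed F)) \<subseteq> {0}" for F :: "'a set"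
    by (intro zariski_dense_iff rim_closure_subset_spec) (auto simp: zariski_closed_def)
  \<comment> \<open>Both conditions are negated, so that each direction starts from a witness: a
    representation of 1, or a set \<open>C\<close>.\<close>
  have "cic_extension P = complete_integral_closure \<longleftrightarrow>
      (\<exists>C. closedin zariski C \<and> cocompact C \<and> P \<in> C \<and> zariski closure_of (rim_closure C) \<noteq> spec)"
  proof
    assume "cic_extension P = complete_integral_closure"
    then obtain ps where ps: "set ps \<subseteq> P \<times> complete_integral_closure"
        "(\<Sum>(p, z)\<leftarrow>ps. to_fract p * z) = 1"
      using cic_extension_eq_cic_iff by blast
    \<comment> \<open>\<open>?C\<close> is cut out by the finitely many elements of \<open>P\<close>
      that occur in the representation of 1.\<close>
    let ?C = "zariski_closed (fst ` set ps)"
    have "\<not> \<Inter>(rim_closure ?C) \<subseteq> {0}"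
      using extension_eq_imp_Inter_rim_closure_nonzero[OF assms(1) _ ps(2)] ps(1) by force
    moreover have "P \<in> ?C" using ps(1) assms(2) by (auto simp: zariski_closed_def)
    ultimately show "\<exists>C. closedin zariski C \<and> cocompact C \<and> P \<in> C \<and>
        zariski closure_of (rim_closure C) \<noteq> spec"
      using closedin_cocompact_finite[of "fst ` set ps"] dense by auto
  next
    assume "\<exists>C. closedin zariski C \<and> cocompact C \<and> P \<in> C \<and>
      zariski closure_of (rim_closure C) \<noteq> spec"
    then obtain F where F: "finite F" "P \<in> zariski_closed F"
        "zariski closure_of (rim_closure (zariski_closed F)) \<noteq> spec"
      using closed_cocompact_finiteE by metis
    then obtain c where c: "c \<noteq> 0" "c \<in> \<Inter>(rim_closure (zariski_closed F))"
      unfolding dense by blast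
    \<comment> \<open>Every member of the rim closure contains the nonzero \<open>c\<close>, which
      excludes the zero prime; so \<open>F\<close> has a nonzero element.\<close>
    then have "{0} \<notin> zariski_closed F" unfolding rim_closure_def by blast
    then obtain g where g: "g \<in> F" "g \<noteq> 0" using zero_notin_zariski_closedD by blast
    obtain ps where ps: "set ps \<subseteq> F \<times> {x. \<forall>h\<in>F. to_fract h * x \<in> range to_fract}"
        "(\<Sum>(p, z)\<leftarrow>ps. to_fract p * z) = 1"
      using prufer_invertible[OF assms(1) F(1) g] by blast
    \<comment> \<open>\<open>F\<close> lies in \<open>P\<close> because \<open>P\<close> is in V(F),
      and the inverse of the ideal lies in \<open>D^*\<close>.\<close>
    have "set ps \<subseteq> P \<times> complete_integral_closure"
      using ps(1) F(2) inverse_ideal_almost_integral[OF assms(1) F(1) g c]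
      unfolding complete_integral_closure_def zariski_closed_def by blast
    then show "cic_extension P = complete_integral_closure"
      using ps(2) cic_extension_eq_cic_iff by blast
  qed
  then show ?thesis using assms(2) unfolding spec_star_def by blast
qed

end
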